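(* Let $K\subset\mathbb{R}^d$ be a cone and let $\mathcal{A}$ be a compact family of $K$-Metzler operators each of which is $K$-irreducible. Let $K'$ be a cone embedded in $K$ such that all operators of $\mathcal{A}$ are $K'$-Metzler. Then there is a constant $C$ such that for all $\tau,\varepsilon>0$ we have $$\check\beta(\tau)-\check\alpha(Q)\ \le\ C\tau+\varepsilon$$ whenever the infinite polytope $Q\subset K$ is $\varepsilon$-extremal for the family $e^{\tau\mathcal{A}}$ and has all its vertices in $K'$.
   Context: Every cone is convex, closed, solid, pointed, with apex at the origin. A linear operator $A$ on $\mathbb{R}^d$ is $K$-Metzler if there is $h>0$ with $(I+hA)K\subset K$. A face of $K$ is the intersection of $K$ with a supporting hyperplane through the apex; $\{0\}$ is the trivial face; a face plane is the linear span of a face. A $K$-Metzler operator is $K$-irreducible if none of the nontrivial face planes of $K$ is invariant under it. A cone $K'$ is embedded in $K$ if $K'\setminus\{0\}\subset\operatorname{int}K$. (For compact families of $K$-Metzler $K$-irreducible operators an embedded cone $K'$ for which all the operators are $K'$-Metzler always exists.) For $M\subset K\setminus\{0\}$ the infinite convex hull is $\mathrm{co}_+(M)=\mathrm{co}(M)+K$. An infinite polytope is the infinite convex hull of a nonempty finite subset of $K\setminus\{0\}$; its vertices are its extreme points. $\operatorname{int}_K$ is the interior in the topology of $K$. The vector $Ax$ at $x\in Q$ is directed inside $Q$ if $x+\eta Ax\in\operatorname{int}_KQ$ for some $\eta>0$. Define $\check\alpha(Q)=\sup\{\alpha\in\mathbb{R}:$ for each vertex $v$ of $Q$ and each $A\in\mathcal{A}$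 the vector $(A-\alpha I)v$ at $v$ is directed inside $Q\}$. $e^{\tau\mathcal{A}}=\{e^{\tau A}:A\in\mathcal{A}\}$; the lower spectral radius is $\check\rho(\mathcal{B})=\lim_{k\to\infty}\min_{B_i\in\mathcal{B}}\|B_k\cdots B_1\|^{1/k}$; $\check\beta(\tau)=\tau^{-1}\ln\check\rho(e^{\tau\mathcal{A}})$. An infinite polytope $Q$ is $\varepsilon$-extremal for $e^{\tau\mathcal{A}}$ if $e^{\tau A}Q\subset e^{-\tau\varepsilon}\check\rho(e^{\tau\mathcal{A}})\,Q$ for all $A\in\mathcal{A}$. *)

theory Defs
  imports "HOL-Analysis.Analysis"
begin

definition proper_cone :: "'a::euclidean_space set \<Rightarrow> bool" where
  "proper_cone K \<longleftrightarrow>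
     convex_cone K \<and> closed K \<and> interior K \<noteq> {} \<and> (\<forall>x. x \<in> K \<and> - x \<in> K \<longrightarrow> x = 0)"

definition cone_metzler :: "'a::euclidean_space set \<Rightarrow> ('a \<Rightarrow>\<^sub>L 'a) \<Rightarrow> bool" where
  "cone_metzler K A \<longleftrightarrow> (\<exists>h>0. (\<lambda>x. x + h *\<^sub>R blinfun_apply A x) ` K \<subseteq> K)"

(* The normal a is nonzero, so K itself is not a face (unlike for the library's face_of). *)
definition cone_face :: "'a::euclidean_space set \<Rightarrow> 'a set \<Rightarrow> bool" where
  "cone_face F K \<longleftrightarrow> (\<exists>a. a \<noteq> 0 \<and> K \<subseteq> {x. 0 \<le> a \<bullet> x} \<and> F = K \<inter> {x. a \<bullet> x = 0})"

definition cone_irreducible :: "'a::euclidean_space set \<Rightarrow> ('a \<Rightarrow>\<^sub>L 'a) \<Rightarrow> bool" where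
  "cone_irreducible K A \<longleftrightarrow>
     (\<forall>F. cone_face F K \<and> F \<noteq> {0} \<longrightarrow> \<not> blinfun_apply A ` span F \<subseteq> span F)"

definition embedded_in :: "'a::euclidean_space set \<Rightarrow> 'a set \<Rightarrow> bool" where
  "embedded_in K' K \<longleftrightarrow> K' - {0} \<subseteq> interior K"

(* The outer + is the Minkowski sum of sets. *)
definition infinite_hull :: "'a::euclidean_space set \<Rightarrow> 'a set \<Rightarrow> 'a set" where
  "infinite_hull K M = (convex hull M) + K"

definition infinite_polytope :: "'a::euclidean_space set \<Rightarrow> 'a set \<Rightarrow> bool" where
  "infinite_polytope K Q \<longleftrightarrow>
     (\<exists>M. finite M \<and> M \<noteq> {} \<and> M \<subseteq> K - {0} \<and> Q = infinite_hull K M)"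

definition vertices :: "'a::euclidean_space set \<Rightarrow> 'a set" where
  "vertices Q = {v. v extreme_point_of Q}"

definition directed_inside :: "'a::euclidean_space set \<Rightarrow> 'a set \<Rightarrow> 'a \<Rightarrow> 'a \<Rightarrow> bool" where
  "directed_inside K Q x w \<longleftrightarrow> (\<exists>\<eta>>0. x + \<eta> *\<^sub>R w \<in> (top_of_set K) interior_of Q)"

(* Extended-real valued, so that the supremum of an empty set of alpha is -\<infinity> and that of an
   unbounded one is \<infinity>. *)
definition lower_alpha ::
    "'a::euclidean_space set \<Rightarrow> ('a \<Rightarrow>\<^sub>L 'a) set \<Rightarrow> 'a set \<Rightarrow> ereal" where
  "lower_alpha K \<A> Q =
     (SUP \<alpha> \<in> {\<alpha>::real. \<forall>v\<in>vertices Q. \<forall>A\<in>\<A>.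
        directed_inside K Q v (blinfun_apply (A - \<alpha> *\<^sub>R id_blinfun) v)}. ereal \<alpha>)"

definition blinfun_exp :: "('a::euclidean_space \<Rightarrow>\<^sub>L 'a) \<Rightarrow> ('a \<Rightarrow>\<^sub>L 'a)" where
  "blinfun_exp A = (\<Sum>n. (1 / fact n) *\<^sub>R ((\<lambda>B. A o\<^sub>L B) ^^ n) id_blinfun)"

definition exp_family :: "real \<Rightarrow> ('a::euclidean_space \<Rightarrow>\<^sub>L 'a) set \<Rightarrow> ('a \<Rightarrow>\<^sub>L 'a) set" where
  "exp_family \<tau> \<A> = (\<lambda>A. blinfun_exp (\<tau> *\<^sub>R A)) ` \<A>"

(* The infimum is a minimum when \<B> is nonempty and compact. *)
definition lower_spectral_radius :: "('a::euclidean_space \<Rightarrow>\<^sub>L 'a) set \<Rightarrow> real" where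
  "lower_spectral_radius \<B> =
     lim (\<lambda>k. INF Bs \<in> {Bs. length Bs = k \<and> set Bs \<subseteq> \<B>}.
                root k (norm (foldr (o\<^sub>L) Bs id_blinfun)))"

definition lower_beta :: "('a::euclidean_space \<Rightarrow>\<^sub>L 'a) set \<Rightarrow> real \<Rightarrow> real" where
  "lower_beta \<A> \<tau> = ln (lower_spectral_radius (exp_family \<tau> \<A>)) / \<tau>"

definition eps_extremal ::
    "real \<Rightarrow> real \<Rightarrow> ('a::euclidean_space \<Rightarrow>\<^sub>L 'a) set \<Rightarrow> 'a set \<Rightarrow> bool" where
  "eps_extremal \<epsilon> \<tau> \<A> Q \<longleftrightarrow>
     (\<forall>A\<in>\<A>. blinfun_apply (blinfun_exp (\<tau> *\<^sub>R A)) ` Q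
        \<subseteq> (\<lambda>x. (exp (- \<tau> * \<epsilon>) * lower_spectral_radius (exp_family \<tau> \<A>)) *\<^sub>R x) ` Q)"

end

theory Submission
  imports Defs
begin

text \<open>
  Put \<open>c = exp (- \<tau> \<epsilon>) \<rho>\<close>, so that \<open>exp (\<tau> A) Q \<subseteq> c Q\<close>. The Metzler property forces \<open>c > 0\<close>, hence
  \<open>c = exp (\<tau> \<sigma>)\<close> with \<open>\<sigma> = \<beta>(\<tau>) - \<epsilon>\<close>. A vertex \<open>v\<close> lies in \<open>K'\<close>, so perturbing it by at most
  \<open>r |v|\<close>, with \<open>r > 0\<close> independent of \<open>v\<close>, stays in \<open>K\<close>. Hence the quadratic Taylor remainder of
  \<open>exp (\<tau> A) v\<close> is absorbed by \<open>O(\<tau>\<^sup>2) v\<close>, and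
  \<open>v + \<tau> A v + O(\<tau>\<^sup>2) v \<in> exp (\<tau> \<sigma>) Q \<subseteq> (1 + \<tau> \<sigma>) Q\<close>. This says that \<open>(A - \<alpha>) v\<close> is directed inside
  \<open>Q\<close> for all \<open>\<alpha> < \<sigma> - O(\<tau>)\<close>. For large \<open>\<tau>\<close> it suffices that \<open>\<sigma>\<close> is bounded above by \<open>sup |A|\<close>
  and \<open>\<alpha>(Q)\<close> below by \<open>- sup |A| / r\<close>.
\<close>

section \<open>The operator exponential: norm estimates and positivity on a cone\<close>

lemma blinfun_compose_pow_apply:
  fixes A :: "'a::euclidean_space \<Rightarrow>\<^sub>L 'a"
  shows "blinfun_apply (((\<lambda>B. A o\<^sub>L B) ^^ n) id_blinfun) x = (blinfun_apply A ^^ n) x"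
  by (induction n) auto

lemma norm_blinfun_pow_apply:
  fixes A :: "'a::euclidean_space \<Rightarrow>\<^sub>L 'a"
  shows "norm ((blinfun_apply A ^^ n) x) \<le> norm A ^ n * norm x"
proof (induction n)
  case (Suc n)
  have "norm ((blinfun_apply A ^^ Suc n) x) \<le> norm A * norm ((blinfun_apply A ^^ n) x)"
    by (simp add: norm_blinfun)
  also have "\<dots> \<le> norm A * (norm A ^ n * norm x)"
    using Suc by (intro mult_left_mono) auto
  finally show ?case by (simp add: mult.assoc)
qed auto

lemma norm_blinfun_compose_pow:
  fixes A :: "'a::euclidean_space \<Rightarrow>\<^sub>L 'a"
  shows "norm (((\<lambda>B. A o\<^sub>L B) ^^ n) id_blinfun) \<le> norm A ^ n"
  by (rule norm_blinfun_bound) (auto simp: blinfun_compose_pow_apply norm_blinfun_pow_apply)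

lemma real_exp_sums: "(\<lambda>n. (1 / fact n) * b ^ n) sums exp (b::real)"
  using exp_converges[of b] by (simp add: field_simps)

lemma blinfun_exp_summable:
  fixes A :: "'a::euclidean_space \<Rightarrow>\<^sub>L 'a"
  shows "summable (\<lambda>n. (1 / fact n) *\<^sub>R ((\<lambda>B. A o\<^sub>L B) ^^ n) id_blinfun)"
proof (rule summable_comparison_test')
  show "summable (\<lambda>n. (1 / fact n) * norm A ^ n)"
    using real_exp_sums sums_summable by blast
  show "norm ((1 / fact n) *\<^sub>R ((\<lambda>B. A o\<^sub>L B) ^^ n) id_blinfun) \<le> (1 / fact n) * norm A ^ n"
    if "n \<ge> 0" for n
    using mult_left_mono[OF norm_blinfun_compose_pow, of "1 / fact n" n A] by simp
qed

lemma blinfun_exp_apply_sums: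
  fixes A :: "'a::euclidean_space \<Rightarrow>\<^sub>L 'a"
  shows "(\<lambda>n. (1 / fact n) *\<^sub>R (blinfun_apply A ^^ n) x) sums blinfun_apply (blinfun_exp A) x"
proof -
  have "(\<lambda>n. (1 / fact n) *\<^sub>R ((\<lambda>B. A o\<^sub>L B) ^^ n) id_blinfun) sums blinfun_exp A"
    unfolding blinfun_exp_def by (rule summable_sums[OF blinfun_exp_summable])
  from bounded_linear.sums[OF blinfun.bounded_linear_left this, of x] show ?thesis
    by (simp add: blinfun.scaleR_left blinfun_compose_pow_apply)
qed

lemma norm_blinfun_exp_apply_le:
  fixes A :: "'a::euclidean_space \<Rightarrow>\<^sub>L 'a"
  shows "norm (blinfun_apply (blinfun_exp A) x) \<le> exp (norm A) * norm x"
proof (rule norm_sums_le[OF blinfun_exp_apply_sums])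
  show "(\<lambda>n. (1 / fact n) * norm A ^ n * norm x) sums (exp (norm A) * norm x)"
    by (rule sums_mult2[OF real_exp_sums])
  show "norm ((1 / fact n) *\<^sub>R (blinfun_apply A ^^ n) x) \<le> (1 / fact n) * norm A ^ n * norm x" for n
    using mult_left_mono[OF norm_blinfun_pow_apply, of "1 / fact n" n A x] by simp
qed

text \<open>The tail from index 2 is compared with the real exponential series through
  \<open>1 / fact (n + 2) \<le> 1 / fact n\<close>, which leaves the quadratic factor in
  front.\<close>

lemma norm_blinfun_exp_taylor:
  fixes A :: "'a::euclidean_space \<Rightarrow>\<^sub>L 'a"
  shows "norm (blinfun_apply (blinfun_exp A) x - x - blinfun_apply A x)
           \<le> (norm A)\<^sup>2 * exp (norm A) * norm x"
proof (rule norm_sums_le)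
  have "(\<lambda>n. (1 / fact (n + 2)) *\<^sub>R (blinfun_apply A ^^ (n + 2)) x) sums
      (blinfun_apply (blinfun_exp A) x
        - (\<Sum>i<2. (1 / fact i) *\<^sub>R (blinfun_apply A ^^ i) x))"
    by (rule sums_split_initial_segment[OF blinfun_exp_apply_sums])
  then show "(\<lambda>n. (1 / fact (n + 2)) *\<^sub>R (blinfun_apply A ^^ (n + 2)) x) sums
      (blinfun_apply (blinfun_exp A) x - x - blinfun_apply A x)"
    by (simp add: numeral_2_eq_2 algebra_simps)
  show "(\<lambda>n. (norm A)\<^sup>2 * ((1 / fact n) * norm A ^ n) * norm x)
      sums ((norm A)\<^sup>2 * exp (norm A) * norm x)"
    by (intro sums_mult2 sums_mult real_exp_sums)
  fix n
  have "norm ((1 / fact (n + 2)) *\<^sub>R (blinfun_apply A ^^ (n + 2)) x)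
      = (1 / fact (n + 2)) * norm ((blinfun_apply A ^^ (n + 2)) x)" by simp
  also have "\<dots> \<le> (1 / fact n) * (norm A ^ (n + 2) * norm x)"
    by (intro mult_mono norm_blinfun_pow_apply frac_le fact_mono) auto
  finally show "norm ((1 / fact (n + 2)) *\<^sub>R (blinfun_apply A ^^ (n + 2)) x)
      \<le> (norm A)\<^sup>2 * ((1 / fact n) * norm A ^ n) * norm x"
    by (simp add: power_add power2_eq_square mult_ac)
qed

text \<open>Since \<open>B\<close> and \<open>s I\<close> commute, the Cauchy product of the two exponential series is the series
  of \<open>exp (B + s I)\<close>, whose terms preserve the cone.\<close>
lemma blinfun_exp_inner_ge:
  fixes B :: "'a::euclidean_space \<Rightarrow>\<^sub>L 'a"
  assumes K: "convex_cone K" and s: "0 \<le> s"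
    and P: "\<And>x. x \<in> K \<Longrightarrow> s *\<^sub>R x + blinfun_apply B x \<in> K"
    and a: "\<And>x. x \<in> K \<Longrightarrow> 0 \<le> a \<bullet> x" and v: "v \<in> K"
  shows "a \<bullet> v \<le> exp s * (a \<bullet> blinfun_apply (blinfun_exp B) v)"
proof -
  define p where "p i = s ^ i / fact i" for i :: nat
  define b where "b i = (1 / fact i) *\<^sub>R (blinfun_apply B ^^ i) v" for i :: nat
  define u where "u k = (\<Sum>i\<le>k. p i *\<^sub>R b (k - i))" for k
  have p_Suc: "(1 + real i) * p (Suc i) = s * p i" for i
    by (simp add: p_def divide_simps)
  have b_Suc: "(1 + real i) *\<^sub>R b (Suc i) = blinfun_apply B (b i)" for i
  proof -
    have "(1 + real i) * (1 / fact (Suc i)) = 1 / fact i" by (simp add: divide_simps)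
    then show ?thesis by (simp only: b_def blinfun.scaleR_right scaleR_scaleR) simp
  qed
  \<comment> \<open>This recursion identifies \<open>u k\<close> as the k-th term of the series of
    exp (B + s I) at \<open>v\<close>. Writing k + 1 as i + (k + 1 - i) splits the weighted sum into
    one part for \<open>p_Suc\<close> and one for \<open>b_Suc\<close>.\<close>
  have u_Suc: "(1 + real k) *\<^sub>R u (Suc k) = s *\<^sub>R u k + blinfun_apply B (u k)" for k
  proof -
    have "(1 + real k) *\<^sub>R u (Suc k)
        = (\<Sum>i\<le>Suc k. (real i * p i) *\<^sub>R b (Suc k - i)
             + p i *\<^sub>R (real (Suc k - i) *\<^sub>R b (Suc k - i)))"
      unfolding u_def scaleR_sum_right
      by (intro sum.cong refl)
        (simp add: of_nat_diff flip: scaleR_add_left, simp add: algebra_simps)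
    also have "\<dots> = (\<Sum>i\<le>Suc k. (real i * p i) *\<^sub>R b (Suc k - i))
        + (\<Sum>i\<le>Suc k. p i *\<^sub>R (real (Suc k - i) *\<^sub>R b (Suc k - i)))"
      by (rule sum.distrib)
    also have "(\<Sum>i\<le>Suc k. (real i * p i) *\<^sub>R b (Suc k - i)) = s *\<^sub>R u k"
      by (subst sum.atMost_Suc_shift) (simp add: p_Suc u_def scaleR_sum_right)
    also have "(\<Sum>i\<le>Suc k. p i *\<^sub>R (real (Suc k - i) *\<^sub>R b (Suc k - i)))
        = (\<Sum>i\<le>k. p i *\<^sub>R blinfun_apply B (b (k - i)))"
      by (simp add: Suc_diff_le add_diff_eq flip: b_Suc)
    also have "\<dots> = blinfun_apply B (u k)"
      by (simp add: u_def blinfun.sum_right blinfun.scaleR_right)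
    finally show ?thesis .
  qed
  have u_K: "u k \<in> K" for k
  proof (induction k)
    case 0
    then show ?case using v by (simp add: u_def p_def b_def)
  next
    case (Suc k)
    have "u (Suc k) = (1 / (1 + real k)) *\<^sub>R ((1 + real k) *\<^sub>R u (Suc k))" by simp
    also have "\<dots> = (1 / (1 + real k)) *\<^sub>R (s *\<^sub>R u k + blinfun_apply B (u k))"
      by (simp only: u_Suc)
    finally show ?case using convex_cone_scaleR[OF K _ P[OF Suc], of "1 / (1 + real k)"] by simp
  qed
  have ps: "p sums exp s" using real_exp_sums[of s] by (simp add: p_def[abs_def])
  have bs: "(\<lambda>n. a \<bullet> b n) sums (a \<bullet> blinfun_apply (blinfun_exp B) v)"
    unfolding b_def by (rule bounded_linear.sums[OF bounded_linear_inner_right blinfun_exp_apply_sums])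
  have sp: "summable (\<lambda>n. norm (p n))"
    using ps s by (simp add: p_def[abs_def] sums_iff)
  have sb: "summable (\<lambda>n. norm (a \<bullet> b n))"
  proof (rule summable_comparison_test')
    show "summable (\<lambda>n. norm a * ((1 / fact n) * norm B ^ n * norm v))"
      by (intro summable_mult summable_mult2 sums_summable[OF real_exp_sums])
    fix n :: nat assume "n \<ge> 0"
    have "norm (a \<bullet> b n) \<le> norm a * norm (b n)" by (simp add: Cauchy_Schwarz_ineq2)
    also have "\<dots> \<le> norm a * ((1 / fact n) * norm B ^ n * norm v)"
      using mult_left_mono[OF norm_blinfun_pow_apply, of "1 / fact n" n B v]
      by (intro mult_left_mono) (simp_all add: b_def)
    finally show "norm (norm (a \<bullet> b n)) \<le> norm a * ((1 / fact n) * norm B ^ n * norm v)" by simp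
  qed
  have "(\<lambda>k. a \<bullet> u k) sums (exp s * (a \<bullet> blinfun_apply (blinfun_exp B) v))"
    using Cauchy_product_sums[OF sp sb] ps bs
    by (simp add: u_def inner_sum_right sums_iff)
  \<comment> \<open>All terms \<open>a \<bullet> u k\<close> are nonnegative, so the sum is at least
    its term of index 0, which is \<open>a \<bullet> v\<close>.\<close>
  moreover have "(\<Sum>k\<in>{0}. a \<bullet> u k) \<le> (\<Sum>k. a \<bullet> u k)"
    using calculation by (intro sum_le_suminf) (auto simp: sums_iff a u_K)
  ultimately show ?thesis by (simp add: sums_iff u_def p_def b_def)
qed

section \<open>Cones, infinite polytopes and orbits inside them\<close>

text \<open>Pointedness makes \<open>K - {0}\<close> convex, so the compact convex hull of the unit
  vectors of \<open>K\<close> misses 0 and can be strictly separated from it. Homogeneity extends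
  the sign to all of \<open>K - {0}\<close>.\<close>

lemma proper_cone_strictly_positive_functional:
  fixes K :: "'a::euclidean_space set"
  assumes "proper_cone K"
  obtains a where "\<And>x. x \<in> K - {0} \<Longrightarrow> 0 < a \<bullet> x"
proof -
  have K: "convex_cone K" and clK: "closed K"
    and ptd: "\<And>x. x \<in> K \<Longrightarrow> - x \<in> K \<Longrightarrow> x = 0"
    using assms by (auto simp: proper_cone_def)
  define S where "S = K \<inter> sphere 0 1"
  have comp: "compact (convex hull S)"
    unfolding S_def using clK by (intro compact_convex_hull closed_Int_compact) auto
  have "convex (K - {0})"
  proof (rule convexI)
    fix x y and u w :: real
    assume x: "x \<in> K - {0}" and y: "y \<in> K - {0}" and uw: "0 \<le> u" "0 \<le> w" "u + w = 1"
    have ux: "u *\<^sub>R x \<in> K" and wy: "w *\<^sub>R y \<in> K"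
      using x y uw convex_cone_scaleR[OF K] by auto
    have "u *\<^sub>R x + w *\<^sub>R y \<noteq> 0"
    proof
      assume 0: "u *\<^sub>R x + w *\<^sub>R y = 0"
      then have "- (u *\<^sub>R x) = w *\<^sub>R y" by (simp add: neg_eq_iff_add_eq_0)
      then have "u *\<^sub>R x = 0" using ptd[OF ux] wy by simp
      then show False using 0 x y uw by auto
    qed
    then show "u *\<^sub>R x + w *\<^sub>R y \<in> K - {0}" using convex_cone_add[OF K ux wy] by simp
  qed
  then have "convex hull S \<subseteq> K - {0}" by (intro hull_minimal) (auto simp: S_def)
  then have "0 \<notin> convex hull S" by auto
  then obtain a b where ab: "0 < b" "\<And>x. x \<in> convex hull S \<Longrightarrow> b < a \<bullet> x"
    using separating_hyperplane_closed_0[of "convex hull S"] comp compact_imp_closed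
    by (metis convex_convex_hull)
  show thesis
  proof (rule that)
    fix x assume x: "x \<in> K - {0}"
    then have "(1 / norm x) *\<^sub>R x \<in> S"
      using convex_cone_scaleR[OF K, of "1 / norm x" x] by (auto simp: S_def)
    then have "0 < a \<bullet> ((1 / norm x) *\<^sub>R x)" using ab hull_inc by (metis order.strict_trans)
    then show "0 < a \<bullet> x" using x by (simp add: zero_less_divide_iff)
  qed
qed

text \<open>The unit vectors of \<open>K'\<close> form a compact subset of the open set
  \<open>interior K\<close>, so one radius serves them all; scaling turns it into a radius
  proportional to \<open>norm v\<close>.\<close>

lemma embedded_in_uniform_ball:
  fixes K K' :: "'a::euclidean_space set"
  assumes "proper_cone K" "proper_cone K'" "embedded_in K' K"
  obtains r where "0 < r" "\<And>v y. v \<in> K' \<Longrightarrow> norm y \<le> r * norm v \<Longrightarrow> v + y \<in> K"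
proof -
  have K: "convex_cone K" and K': "convex_cone K'" and clK': "closed K'"
    using assms by (auto simp: proper_cone_def)
  have "compact (K' \<inter> sphere 0 1)" using clK' by (intro closed_Int_compact) auto
  moreover have "K' \<inter> sphere 0 1 \<subseteq> interior K"
    using assms(3) by (auto simp: embedded_in_def)
  ultimately obtain r where r: "0 < r" "(\<Union>x\<in>K' \<inter> sphere 0 1. cball x r) \<subseteq> interior K"
    by (metis compact_subset_open_imp_cball_epsilon_subset open_interior)
  show thesis
  proof (rule that[OF r(1)])
    fix v y :: 'a
    assume v: "v \<in> K'" and y: "norm y \<le> r * norm v"
    show "v + y \<in> K"
    proof (cases "v = 0")
      case True
      then show ?thesis using y convex_cone_contains_0[OF K] by simp
    next
      case False
      let ?e = "(1 / norm v) *\<^sub>R v"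
      have "?e \<in> K' \<inter> sphere 0 1"
        using False v convex_cone_scaleR[OF K', of "1 / norm v" v] by auto
      moreover have "?e + (1 / norm v) *\<^sub>R y \<in> cball ?e r"
        using y False by (simp add: dist_norm field_simps)
      ultimately have "?e + (1 / norm v) *\<^sub>R y \<in> K" using r(2) interior_subset by blast
      from convex_cone_scaleR[OF K _ this, of "norm v"] show ?thesis
        using False by (simp add: scaleR_add_right)
    qed
  qed
qed

lemma infinite_hull_add:
  assumes "convex_cone K" "q \<in> infinite_hull K M" "k \<in> K"
  shows "q + k \<in> infinite_hull K M"
proof -
  obtain h j where "h \<in> convex hull M" "j \<in> K" "q = h + j"
    using assms(2) by (auto simp: infinite_hull_def elim: set_plus_elim)
  then show ?thesis using convex_cone_add[OF assms(1) \<open>j \<in> K\<close> assms(3)]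
    by (auto simp: infinite_hull_def add.assoc intro: set_plus_intro)
qed

text \<open>The functional is positive on the finitely many generators, and adding elements of
  \<open>K\<close> cannot lower it. This keeps \<open>Q\<close> away from the origin.\<close>

lemma infinite_polytope_inner_bounded_below:
  assumes "infinite_polytope K Q" and a: "\<And>x. x \<in> K - {0} \<Longrightarrow> 0 < a \<bullet> x"
  obtains m where "0 < m" "\<And>x. x \<in> Q \<Longrightarrow> m \<le> a \<bullet> x"
proof -
  obtain M where M: "finite M" "M \<noteq> {}" "M \<subseteq> K - {0}" "Q = infinite_hull K M"
    using assms(1) by (auto simp: infinite_polytope_def)
  define m where "m = Min ((\<lambda>x. a \<bullet> x) ` M)"
  have "0 < m" using M a by (auto simp: m_def Min_gr_iff)
  moreover have "m \<le> a \<bullet> x" if x: "x \<in> Q" for x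
  proof -
    obtain h k where hk: "h \<in> convex hull M" "k \<in> K" "x = h + k"
      using x M(4) by (auto simp: infinite_hull_def elim: set_plus_elim)
    have "M \<subseteq> {x. m \<le> a \<bullet> x}" using M by (auto simp: m_def)
    then have "convex hull M \<subseteq> {x. m \<le> a \<bullet> x}"
      by (rule hull_minimal) (use convex_halfspace_ge[of m a] in simp)
    then have "m \<le> a \<bullet> h" using hk by auto
    moreover have "0 \<le> a \<bullet> k" using a hk by (cases "k = 0") (auto intro: less_imp_le)
    ultimately show ?thesis by (simp add: hk inner_add_right)
  qed
  ultimately show thesis by (rule that)
qed

text \<open>The translate \<open>q + interior K\<close> is open and lies in \<open>Q\<close>. This
  turns membership in \<open>Q\<close> into membership in its relative interior after adding any
  small positive multiple of an interior vector.\<close>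

lemma add_interior_cone_in_interior_of:
  fixes K Q :: "'a::euclidean_space set"
  assumes QK: "\<And>q k. q \<in> Q \<Longrightarrow> k \<in> K \<Longrightarrow> q + k \<in> Q" and sub: "Q \<subseteq> K"
    and q: "q \<in> Q" and v: "v \<in> interior K"
  shows "q + v \<in> (top_of_set K) interior_of Q"
proof -
  let ?T = "(+) q ` interior K"
  have op: "open ?T" by (intro open_translation open_interior)
  have "?T \<subseteq> Q" using QK q interior_subset by blast
  moreover have "openin (top_of_set K) ?T"
    using op calculation sub by (metis open_openin_trans open_subset subset_trans)
  ultimately show ?thesis using v by (auto simp: interior_of_def)
qed

lemma interior_scaleR_cone:
  fixes K :: "'a::euclidean_space set"
  assumes "convex_cone K" "0 < c" "v \<in> interior K"
  shows "c *\<^sub>R v \<in> interior K"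
proof -
  have "(\<lambda>x. c *\<^sub>R x) ` interior K \<subseteq> K"
    using convex_cone_scaleR[OF assms(1), of c] assms(2) interior_subset[of K] by auto
  moreover have "open ((\<lambda>x. c *\<^sub>R x) ` interior K)"
    using assms(2) by (intro open_scaling) auto
  ultimately show ?thesis using assms(3) by (meson image_eqI interior_maximal subsetD)
qed

text \<open>Iterating the inclusion keeps the orbit of \<open>v\<close> at level at least \<open>c ^ k * m\<close>.\<close>
lemma inclusion_factor_le:
  fixes E :: "'a::euclidean_space \<Rightarrow>\<^sub>L 'a"
  assumes inc: "blinfun_apply E ` Q \<subseteq> (\<lambda>x. c *\<^sub>R x) ` Q" and c: "0 < c"
    and m: "0 < m" "\<And>x. x \<in> Q \<Longrightarrow> m \<le> a \<bullet> x" and v: "v \<in> Q"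
  shows "c \<le> norm E"
proof (rule ccontr)
  assume "\<not> c \<le> norm E"
  then have lt: "norm E < c" by simp
  have orb: "\<exists>q\<in>Q. (blinfun_apply E ^^ k) v = c ^ k *\<^sub>R q" for k
  proof (induction k)
    case (Suc k)
    then obtain q where q: "q \<in> Q" "(blinfun_apply E ^^ k) v = c ^ k *\<^sub>R q" by blast
    obtain q' where "q' \<in> Q" "blinfun_apply E q = c *\<^sub>R q'" using inc q(1) by blast
    then show ?case using q by (auto simp: blinfun.scaleR_right mult.commute intro!: bexI[of _ q'])
  qed (use v in auto)
  have le: "m \<le> norm a * norm v * (norm E / c) ^ k" for k
  proof -
    obtain q where q: "q \<in> Q" "(blinfun_apply E ^^ k) v = c ^ k *\<^sub>R q" using orb by blast
    have "c ^ k * m \<le> a \<bullet> (c ^ k *\<^sub>R q)" using m(2)[OF q(1)] c by simp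
    also have "\<dots> \<le> norm a * norm ((blinfun_apply E ^^ k) v)"
      unfolding q(2) by (rule norm_cauchy_schwarz)
    also have "\<dots> \<le> norm a * (norm E ^ k * norm v)"
      by (intro mult_left_mono norm_blinfun_pow_apply) auto
    finally show ?thesis using c by (simp add: power_divide field_simps)
  qed
  \<comment> \<open>With \<open>norm E < c\<close> the upper bound for \<open>m\<close> decays
    geometrically, contradicting \<open>m > 0\<close>.\<close>
  have "(\<lambda>k. norm a * norm v * (norm E / c) ^ k) \<longlonglongrightarrow> norm a * norm v * 0"
    using lt c by (intro tendsto_intros LIMSEQ_realpow_zero) auto
  then have "m \<le> norm a * norm v * 0"
    by (rule LIMSEQ_le_const) (use le in auto)
  then show False using m(1) by simp
qed

section \<open>From the inclusion for the exponential to directed vectors\<close>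

text \<open>Either \<alpha> is so negative that \<open>- \<alpha> *\<^sub>R v\<close> alone
  outweighs \<open>A v\<close>, or the bound on \<alpha> forces \<tau> to be small and the Taylor
  expansion applies. The constant is built to serve both cases.\<close>

lemma directed_inside_of_exp_mem:
  fixes A :: "'a::euclidean_space \<Rightarrow>\<^sub>L 'a"
  assumes K: "convex_cone K"
    and QK: "\<And>q k. q \<in> Q \<Longrightarrow> k \<in> K \<Longrightarrow> q + k \<in> Q" and sub: "Q \<subseteq> K"
    and v: "v \<in> Q" "v \<in> interior K"
    and r: "0 < r" "\<And>y. norm y \<le> r * norm v \<Longrightarrow> v + y \<in> K"
    and L: "0 < L" "norm A \<le> L" and \<tau>: "0 < \<tau>" and \<sigma>: "\<sigma> \<le> L"
    and q: "q \<in> Q" "blinfun_apply (blinfun_exp (\<tau> *\<^sub>R A)) v = exp (\<tau> * \<sigma>) *\<^sub>R q"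
    and \<alpha>: "\<alpha> < \<sigma> - ((L + L / r) * (1 + L / r) + L\<^sup>2 * exp L / r) * \<tau>"
  shows "directed_inside K Q v (blinfun_apply (A - \<alpha> *\<^sub>R id_blinfun) v)"
proof -
  \<comment> \<open>The multiple \<open>s *\<^sub>R v\<close> absorbs \<open>A v\<close>, and
    \<open>(D * \<tau>\<^sup>2) *\<^sub>R v\<close> absorbs the Taylor remainder when \<tau> <
    1.\<close>
  define s where "s = L / r"
  define D where "D = L\<^sup>2 * exp L / r"
  have s: "0 < s" and D: "0 < D" using L r by (auto simp: s_def D_def)
  have absorb: "c *\<^sub>R v + y \<in> K" if "0 < c" "norm y \<le> c * r * norm v" for c y
  proof -
    have "norm ((1 / c) *\<^sub>R y) \<le> r * norm v" using that by (simp add: field_simps)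
    from convex_cone_scaleR[OF K _ r(2)[OF this], of c] that show ?thesis
      by (simp add: scaleR_add_right)
  qed
  have push: "p + c *\<^sub>R v \<in> (top_of_set K) interior_of Q" if "p \<in> Q" "0 < c" for p c
    using add_interior_cone_in_interior_of[OF QK sub that(1)] interior_scaleR_cone[OF K that(2) v(2)]
    by blast
  have \<alpha>': "\<alpha> < \<sigma> - ((L + s) * (1 + s) + D) * \<tau>" using \<alpha> by (simp add: s_def D_def)
  show ?thesis
  proof (cases "\<alpha> < - s")
    case True
    have "norm (blinfun_apply A v) \<le> L * norm v"
      using norm_blinfun[of A v] mult_right_mono[OF L(2), of "norm v"] by simp
    then have "s *\<^sub>R v + blinfun_apply A v \<in> K" using r by (intro absorb s) (simp add: s_def)
    then have "v + (s *\<^sub>R v + blinfun_apply A v) + (- \<alpha> - s) *\<^sub>R v \<in> (top_of_set K) interior_of Q"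
      using True v by (intro push QK) auto
    moreover have "v + (s *\<^sub>R v + blinfun_apply A v) + (- \<alpha> - s) *\<^sub>R v
        = v + 1 *\<^sub>R blinfun_apply (A - \<alpha> *\<^sub>R id_blinfun) v"
      by (simp add: blinfun.diff_left blinfun.scaleR_left algebra_simps)
    ultimately show ?thesis unfolding directed_inside_def by (metis zero_less_one)
  next
    case False
    \<comment> \<open>Here - s \<le> \<alpha> and \<sigma> \<le> L, so the gap between \<sigma> and
      \<alpha> is at most L + s. The summand \<open>(L + s) * (1 + s)\<close> of the constant is
      chosen so that cancelling L + s gives (1 + s) \<tau> < 1.\<close>
    have "((L + s) * (1 + s) + D) * \<tau> < L + s" using False \<alpha>' \<sigma> by linarith
    moreover have "(L + s) * (1 + s) * \<tau> \<le> ((L + s) * (1 + s) + D) * \<tau>"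
      using D \<tau> by (intro mult_right_mono) auto
    ultimately have "(L + s) * ((1 + s) * \<tau>) < (L + s) * 1" by (simp add: mult.assoc)
    then have small: "(1 + s) * \<tau> < 1" using L s by (simp only: mult_less_cancel_left_pos add_pos_pos)
    have s\<tau>: "0 < s * \<tau>" using s \<tau> by simp
    have \<tau>1: "\<tau> < 1" using small s\<tau> by (simp add: distrib_right)
    have "0 < ((L + s) * (1 + s) + D) * \<tau>" using L s D \<tau> by (intro mult_pos_pos add_pos_pos) auto
    then have "- s < \<sigma>" using False \<alpha>' by linarith
    then have "- (s * \<tau>) < \<tau> * \<sigma>" using \<tau> mult_strict_left_mono[of "- s" \<sigma> \<tau>] by (simp add: mult.commute)
    \<comment> \<open>The linearization of exp (\<tau> \<sigma>); it exceeds 1 - s \<tau>, which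
      exceeds \<tau>, so division by it is legitimate.\<close>
    define g where "g = 1 + \<tau> * \<sigma>"
    have g: "0 < g" using small \<tau> \<open>- (s * \<tau>) < \<tau> * \<sigma>\<close> by (simp add: g_def distrib_right)
    define R where "R = blinfun_apply (blinfun_exp (\<tau> *\<^sub>R A)) v - v - \<tau> *\<^sub>R blinfun_apply A v"
    have nA: "norm (\<tau> *\<^sub>R A) \<le> \<tau> * L" using \<tau> L by simp
    have "norm R \<le> (norm (\<tau> *\<^sub>R A))\<^sup>2 * exp (norm (\<tau> *\<^sub>R A)) * norm v"
      using norm_blinfun_exp_taylor[of "\<tau> *\<^sub>R A" v] by (simp add: R_def blinfun.scaleR_left)
    also have "\<dots> \<le> (\<tau> * L)\<^sup>2 * exp L * norm v"
    proof -
      have "\<tau> * L \<le> 1 * L" using \<tau>1 L by (intro mult_right_mono) auto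
      then have "norm (\<tau> *\<^sub>R A) \<le> L" using nA by linarith
      then show ?thesis using nA by (intro mult_right_mono mult_mono power_mono) auto
    qed
    also have "\<dots> = (D * \<tau>\<^sup>2) * r * norm v" using r by (simp add: D_def power_mult_distrib)
    finally have k: "(D * \<tau>\<^sup>2) *\<^sub>R v + (- R) \<in> K" using D \<tau> by (intro absorb) auto
    \<comment> \<open>Collects, after division by \<open>g\<close>, the two errors of linearization:
      the excess of exp (\<tau> \<sigma>) over \<open>g\<close>, carried by \<open>q\<close>, and
      the absorbed Taylor remainder. Both lie in \<open>K\<close>.\<close>
    define j where "j = ((exp (\<tau> * \<sigma>) / g - 1) *\<^sub>R q) + (1 / g) *\<^sub>R ((D * \<tau>\<^sup>2) *\<^sub>R v + (- R))"
    have "g \<le> exp (\<tau> * \<sigma>)" unfolding g_def by (rule exp_ge_add_one_self)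
    then have jK: "j \<in> K"
      unfolding j_def using g q sub
      by (intro convex_cone_add[OF K] convex_cone_scaleR[OF K _ k] convex_cone_scaleR[OF K, of _ q]) auto
    \<comment> \<open>The multiple of \<open>v\<close> left over when the step of length \<tau> / g
      along (A - \<alpha> I) v is written as \<open>q + j\<close> plus a rest; its positivity puts
      the endpoint into the relative interior.\<close>
    define c where "c = \<tau> / g * (\<sigma> - \<alpha> - D * \<tau>)"
    have "D * \<tau> \<le> ((L + s) * (1 + s) + D) * \<tau>" using L s \<tau> by (intro mult_right_mono) auto
    then have "0 < \<sigma> - \<alpha> - D * \<tau>" using \<alpha>' by linarith
    then have c: "0 < c" unfolding c_def using g \<tau> by (intro mult_pos_pos divide_pos_pos)
    have "q + j + c *\<^sub>R v \<in> (top_of_set K) interior_of Q" by (rule push[OF QK[OF q(1) jK] c])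
    moreover have "q + j + c *\<^sub>R v = v + (\<tau> / g) *\<^sub>R blinfun_apply (A - \<alpha> *\<^sub>R id_blinfun) v"
    proof -
      have "g *\<^sub>R (q + j + c *\<^sub>R v)
          = exp (\<tau> * \<sigma>) *\<^sub>R q + ((D * \<tau>\<^sup>2) *\<^sub>R v - R) + (\<tau> * (\<sigma> - \<alpha> - D * \<tau>)) *\<^sub>R v"
        using g by (simp add: j_def c_def algebra_simps)
      also have "\<dots> = v + \<tau> *\<^sub>R blinfun_apply A v + (D * \<tau>\<^sup>2) *\<^sub>R v + (\<tau> * (\<sigma> - \<alpha> - D * \<tau>)) *\<^sub>R v"
        by (simp add: R_def q(2))
      also have "\<dots> = g *\<^sub>R v + \<tau> *\<^sub>R (blinfun_apply A v - \<alpha> *\<^sub>R v)"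
        by (simp add: g_def algebra_simps power2_eq_square)
      also have "\<dots> = g *\<^sub>R (v + (\<tau> / g) *\<^sub>R blinfun_apply (A - \<alpha> *\<^sub>R id_blinfun) v)"
        using g by (simp add: blinfun.diff_left blinfun.scaleR_left scaleR_add_right)
      finally show ?thesis using g by simp
    qed
    ultimately show ?thesis unfolding directed_inside_def using g \<tau> by (metis divide_pos_pos)
  qed
qed

section \<open>The uniform constant and the lower bound for \<open>lower_alpha\<close>\<close>

theorem theorem6:
  fixes K K' :: "(real ^ 'd) set"
    and \<A> :: "((real ^ 'd) \<Rightarrow>\<^sub>L (real ^ 'd)) set"
  assumes "proper_cone K"
    and "compact \<A>"
    and "\<forall>A\<in>\<A>. cone_metzler K A"
    and "\<forall>A\<in>\<A>. cone_irreducible K A"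
    and "proper_cone K'"
    and "embedded_in K' K"
    and "\<forall>A\<in>\<A>. cone_metzler K' A"
  shows "\<exists>C::real. \<forall>\<tau>>0. \<forall>\<epsilon>>0. \<forall>Q.
           infinite_polytope K Q \<and> Q \<subseteq> K \<and> eps_extremal \<epsilon> \<tau> \<A> Q \<and> vertices Q \<subseteq> K'
           \<longrightarrow> ereal (lower_beta \<A> \<tau>) - lower_alpha K \<A> Q \<le> ereal (C * \<tau> + \<epsilon>)"
proof -
  have K: "convex_cone K" using assms(1) by (simp add: proper_cone_def)
  obtain a where a: "\<And>x. x \<in> K - {0} \<Longrightarrow> 0 < a \<bullet> x"
    using proper_cone_strictly_positive_functional[OF assms(1)] by blast
  then have a0: "0 \<le> a \<bullet> x" if "x \<in> K" for x
    using that by (cases "x = 0") (auto intro: less_imp_le)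
  obtain r where r: "0 < r" "\<And>v y. v \<in> K' \<Longrightarrow> norm y \<le> r * norm v \<Longrightarrow> v + y \<in> K"
    using embedded_in_uniform_ball[OF assms(1,5,6)] by blast
  obtain L where L: "0 < L" "\<And>A. A \<in> \<A> \<Longrightarrow> norm A \<le> L"
    using compact_imp_bounded[OF assms(2)] unfolding bounded_pos by blast
  \<comment> \<open>Depends only on the norm bound \<open>L\<close> and the embedding radius
    \<open>r\<close>, hence not on \<tau>, \<epsilon> or \<open>Q\<close>.\<close>
  define C where "C = (L + L / r) * (1 + L / r) + L\<^sup>2 * exp L / r"
  show ?thesis
  proof (intro exI[of _ C] allI impI, elim conjE)
    fix \<tau> \<epsilon> :: real and Q
    assume \<tau>: "0 < \<tau>" and \<epsilon>: "0 < \<epsilon>" and poly: "infinite_polytope K Q" and sub: "Q \<subseteq> K"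
      and ext: "eps_extremal \<epsilon> \<tau> \<A> Q" and vert: "vertices Q \<subseteq> K'"
    have QK: "q + k \<in> Q" if "q \<in> Q" "k \<in> K" for q k
      using poly infinite_hull_add[OF K] that by (auto simp: infinite_polytope_def)
    obtain m where m: "0 < m" "\<And>x. x \<in> Q \<Longrightarrow> m \<le> a \<bullet> x"
      using infinite_polytope_inner_bounded_below[OF poly a] by blast
    define \<rho> where "\<rho> = lower_spectral_radius (exp_family \<tau> \<A>)"
    define c where "c = exp (- \<tau> * \<epsilon>) * \<rho>"
    define \<sigma> where "\<sigma> = lower_beta \<A> \<tau> - \<epsilon>"
    have directed: "directed_inside K Q v (blinfun_apply (A - \<alpha> *\<^sub>R id_blinfun) v)"
      if \<alpha>: "\<alpha> < \<sigma> - C * \<tau>" and v: "v \<in> vertices Q" and A: "A \<in> \<A>" for \<alpha> v A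
    proof -
      let ?E = "blinfun_exp (\<tau> *\<^sub>R A)"
      have vQ: "v \<in> Q" using v by (simp add: vertices_def extreme_point_of_def)
      then have vK: "v \<in> K" using sub by auto
      have v0: "v \<noteq> 0" using m vQ by fastforce
      have v': "v \<in> K'" using v vert by auto
      then have vint: "v \<in> interior K" using v0 assms(6) by (auto simp: embedded_in_def)
      have inc: "blinfun_apply ?E ` Q \<subseteq> (\<lambda>x. c *\<^sub>R x) ` Q"
        using ext A by (simp add: eps_extremal_def c_def \<rho>_def)
      then obtain q where q: "q \<in> Q" "blinfun_apply ?E v = c *\<^sub>R q" using vQ by blast
      obtain h where h: "0 < h" "(\<lambda>x. x + h *\<^sub>R blinfun_apply A x) ` K \<subseteq> K"
        using assms(3) A by (auto simp: cone_metzler_def)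
      \<comment> \<open>The Metzler step \<open>h\<close> for \<open>A\<close> becomes the shift s =
        \<tau> / h for the operator \<tau> A.\<close>
      have P: "(\<tau> / h) *\<^sub>R x + blinfun_apply (\<tau> *\<^sub>R A) x \<in> K" if "x \<in> K" for x
      proof -
        have "x + h *\<^sub>R blinfun_apply A x \<in> K" using h that by auto
        from convex_cone_scaleR[OF K _ this, of "\<tau> / h"] h \<tau> show ?thesis
          by (simp add: scaleR_add_right blinfun.scaleR_left)
      qed
      \<comment> \<open>The exponential cannot send \<open>v\<close> to a vector on which the
        functional vanishes, so c > 0 and \<rho> > 0. Only then is \<open>ln \<rho>\<close> a true
        logarithm and c = exp (\<tau> \<sigma>).\<close>
      have "0 < a \<bullet> v" using a vK v0 by simp
      also have "\<dots> \<le> exp (\<tau> / h) * (a \<bullet> blinfun_apply ?E v)"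
        using h \<tau> by (intro blinfun_exp_inner_ge[OF K _ P a0 vK]) auto
      finally have "0 < c * (a \<bullet> q)" by (simp add: q zero_less_mult_iff)
      then have c: "0 < c" using a0[of q] q sub by (auto simp: zero_less_mult_iff)
      then have "0 < \<rho>" by (simp add: c_def zero_less_mult_iff)
      then have c_eq: "c = exp (\<tau> * \<sigma>)"
        using \<tau> exp_add[of "- (\<tau> * \<epsilon>)" "ln \<rho>"]
        by (simp add: c_def \<sigma>_def lower_beta_def \<rho>_def[symmetric] right_diff_distrib)
      have "c \<le> norm ?E" by (rule inclusion_factor_le[OF inc c m vQ])
      also have "\<dots> \<le> exp (norm (\<tau> *\<^sub>R A))"
        by (rule norm_blinfun_bound) (rule exp_ge_zero norm_blinfun_exp_apply_le)+
      finally have "\<tau> * \<sigma> \<le> \<tau> * norm A" using \<tau> by (simp add: c_eq)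
      then have "\<sigma> \<le> L" using \<tau> L(2)[OF A] by simp
      show ?thesis
        using directed_inside_of_exp_mem[OF K QK sub vQ vint r(1) r(2)[OF v'] L(1) L(2)[OF A] \<tau>
            \<open>\<sigma> \<le> L\<close> q(1)] q(2) \<alpha>
        by (simp add: c_eq C_def)
    qed
    have "ereal (\<sigma> - C * \<tau>) \<le> lower_alpha K \<A> Q"
    \<comment> \<open>Every real \<alpha> strictly below the bound is admissible in the supremum, so
      the bound is approached from below.\<close>
    proof (rule dense_le)
      fix y assume y: "y < ereal (\<sigma> - C * \<tau>)"
      show "y \<le> lower_alpha K \<A> Q"
      proof (cases y)
        case (real \<alpha>)
        then show ?thesis
          unfolding lower_alpha_def using y directed by (auto intro!: SUP_upper)
      qed (use y in auto)
    qed
    \<comment> \<open>The value \<infinity> of \<open>lower_alpha\<close> makes the left side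
      -\<infinity>; the value -\<infinity> is excluded by the real lower bound just shown.\<close>
    then show "ereal (lower_beta \<A> \<tau>) - lower_alpha K \<A> Q \<le> ereal (C * \<tau> + \<epsilon>)"
      by (cases "lower_alpha K \<A> Q") (auto simp: \<sigma>_def)
  qed
qed

end
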